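(* Let $\alpha_1, A_1, \alpha_2 > 0$ and consider the system of difference equations $$x_{n+1}=\frac{\alpha_{1}}{A_{1}+y_{n}},\qquad y_{n+1}=\frac{\alpha_{2}+x_{n}}{x_{n}},\qquad n=0,1,2,\dots,$$ with arbitrary nonnegative initial conditions $x_0,y_0$ such that the denominators are never zero. (1) If $\alpha_{1}> \alpha_{2}$, then there is a unique nonnegative equilibrium, namely $$\left(\frac{\alpha_{1}-\alpha_{2}}{A_{1}+1},\frac{\alpha_{1}+\alpha_{2}A_{1}}{\alpha_{1}-\alpha_{2}}\right),$$ and it is globally asymptotically stable. (2) If $\alpha_{1}\leq \alpha_{2}$, then for an arbitrary choice of initial conditions $\lim_{n\rightarrow\infty}(x_{n},y_{n})=(0,\infty)$.
   Context: The state space consists of nonnegative points. An initial condition $(x_0,y_0)\in[0,\infty)^2$ is admissible if no denominator ever vanishes along its orbit (here this means $x_0>0$, $y_0\ge 0$). A nonnegative equilibrium is an admissible point $(\bar x,\bar y)\in[0,\infty)^2$ such that the constant sequence $(x_n,y_n)=(\bar x,\bar y)$ solves the system. It is globally asymptotically stable if it is Lyapunov stable (for every $\varepsilon>0$ there is $\delta>0$ such that every admissible initial condition within $\delta$ of $(\bar x,\bar y)$ has its whole orbit within $\varepsilon$ of $(\bar x,\bar y)$) and every solution with admissible initial condition converges to $(\bar x,\bar y)$. The notation $\lim_{n\to\infty}(x_n,y_n)=(0,\infty)$ means $x_n\to 0$ and $y_n\to\infty$. *)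

theory Defs
  imports "HOL-Analysis.Analysis"
begin

text \<open>
  The system is x(n+1) = a1 / (A1 + y(n)), y(n+1) = (a2 + x(n)) / x(n); points of the plane are
  pairs (x, y). Division in HOL is total, so the map below is defined everywhere; it is the
  predicate \<open>admissible\<close> that excludes initial conditions whose orbit meets a zero denominator.
\<close>

definition sys_map :: "real \<Rightarrow> real \<Rightarrow> real \<Rightarrow> real \<times> real \<Rightarrow> real \<times> real" where
  "sys_map \<alpha>1 A1 \<alpha>2 p = (\<alpha>1 / (A1 + snd p), (\<alpha>2 + fst p) / fst p)"

definition orbit :: "real \<Rightarrow> real \<Rightarrow> real \<Rightarrow> real \<times> real \<Rightarrow> nat \<Rightarrow> real \<times> real" where
  "orbit \<alpha>1 A1 \<alpha>2 p n = (sys_map \<alpha>1 A1 \<alpha>2 ^^ n) p"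

definition admissible :: "real \<Rightarrow> real \<Rightarrow> real \<Rightarrow> real \<times> real \<Rightarrow> bool" where
  "admissible \<alpha>1 A1 \<alpha>2 p \<longleftrightarrow>
     0 \<le> fst p \<and> 0 \<le> snd p \<and>
     (\<forall>n. A1 + snd (orbit \<alpha>1 A1 \<alpha>2 p n) \<noteq> 0 \<and> fst (orbit \<alpha>1 A1 \<alpha>2 p n) \<noteq> 0)"

definition solution :: "real \<Rightarrow> real \<Rightarrow> real \<Rightarrow> (nat \<Rightarrow> real \<times> real) \<Rightarrow> bool" where
  "solution \<alpha>1 A1 \<alpha>2 s \<longleftrightarrow>
     admissible \<alpha>1 A1 \<alpha>2 (s 0) \<and> (\<forall>n. s (Suc n) = sys_map \<alpha>1 A1 \<alpha>2 (s n))"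

definition nonneg_equilibrium :: "real \<Rightarrow> real \<Rightarrow> real \<Rightarrow> real \<times> real \<Rightarrow> bool" where
  "nonneg_equilibrium \<alpha>1 A1 \<alpha>2 p \<longleftrightarrow> solution \<alpha>1 A1 \<alpha>2 (\<lambda>n. p)"

definition lyapunov_stable :: "real \<Rightarrow> real \<Rightarrow> real \<Rightarrow> real \<times> real \<Rightarrow> bool" where
  "lyapunov_stable \<alpha>1 A1 \<alpha>2 p \<longleftrightarrow>
     (\<forall>\<epsilon>>0. \<exists>\<delta>>0. \<forall>s. solution \<alpha>1 A1 \<alpha>2 s \<longrightarrow> dist (s 0) p < \<delta> \<longrightarrow>
        (\<forall>n. dist (s n) p < \<epsilon>))"

definition globally_asymptotically_stable ::
    "real \<Rightarrow> real \<Rightarrow> real \<Rightarrow> real \<times> real \<Rightarrow> bool" where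
  "globally_asymptotically_stable \<alpha>1 A1 \<alpha>2 p \<longleftrightarrow>
     lyapunov_stable \<alpha>1 A1 \<alpha>2 p \<and> (\<forall>s. solution \<alpha>1 A1 \<alpha>2 s \<longrightarrow> s \<longlonglongrightarrow> p)"

text \<open>The solutions are exactly the orbits of the admissible initial conditions.\<close>

lemma solution_iff_orbit:
  "solution \<alpha>1 A1 \<alpha>2 s \<longleftrightarrow>
     admissible \<alpha>1 A1 \<alpha>2 (s 0) \<and> s = orbit \<alpha>1 A1 \<alpha>2 (s 0)"
proof -
  have "s n = orbit \<alpha>1 A1 \<alpha>2 (s 0) n" if "\<forall>n. s (Suc n) = sys_map \<alpha>1 A1 \<alpha>2 (s n)" for n
    using that by (induction n) (simp_all add: orbit_def)
  moreover have "s (Suc n) = sys_map \<alpha>1 A1 \<alpha>2 (s n)" if "s = orbit \<alpha>1 A1 \<alpha>2 (s 0)" for n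
  proof -
    have "s m = (sys_map \<alpha>1 A1 \<alpha>2 ^^ m) (s 0)" for m
      using fun_cong[OF that, of m] by (simp add: orbit_def)
    from this[of "Suc n"] this[of n] show ?thesis by simp
  qed
  ultimately show ?thesis
    unfolding solution_def by blast
qed

lemma admissible_iff:
  assumes "\<alpha>1 > 0" and "A1 > 0" and "\<alpha>2 > 0"
  shows "admissible \<alpha>1 A1 \<alpha>2 p \<longleftrightarrow> fst p > 0 \<and> snd p \<ge> 0"
proof
  assume "admissible \<alpha>1 A1 \<alpha>2 p"
  then have "0 \<le> fst p" "0 \<le> snd p" "fst (orbit \<alpha>1 A1 \<alpha>2 p 0) \<noteq> 0"
    unfolding admissible_def by blast+
  then show "fst p > 0 \<and> snd p \<ge> 0" by (simp add: orbit_def)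
next
  assume p: "fst p > 0 \<and> snd p \<ge> 0"
  have "fst (orbit \<alpha>1 A1 \<alpha>2 p n) > 0 \<and> snd (orbit \<alpha>1 A1 \<alpha>2 p n) \<ge> 0" for n
    using p assms by (induction n) (simp_all add: orbit_def sys_map_def)
  with p assms show "admissible \<alpha>1 A1 \<alpha>2 p"
    unfolding admissible_def by (metis add_pos_nonneg less_imp_le less_irrefl)
qed

end

(* Eliminating x gives the affine recurrence y(n+2) = r y(n) + 1 + r A1 with r = \<alpha>2 / \<alpha>1,
   which decouples the even- and odd-indexed terms. For r < 1 both subsequences converge
   geometrically to the fixed point; for r \<ge> 1 every second step increases y by at least 1.
   The behaviour of x follows from x(n+1) = \<alpha>1 / (A1 + y(n)). *)
theory Submission
  imports Defs "HOL-Probability.Characteristic_Functions" "HOL-Real_Asymp.Real_Asymp"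
begin

locale positive_system =
  fixes a A b :: real
  assumes a_pos: "a > 0" and A_pos: "A > 0" and b_pos: "b > 0"
begin

lemma solution_pos:
  assumes "solution a A b s"
  shows "fst (s n) > 0" "snd (s n) \<ge> 0"
proof -
  have "fst (s n) > 0 \<and> snd (s n) \<ge> 0"
  proof (induction n)
    case 0
    show ?case
      using assms admissible_iff[OF a_pos A_pos b_pos] by (simp add: solution_def)
  next
    case (Suc n)
    then show ?case
      using assms a_pos A_pos b_pos by (simp add: solution_def sys_map_def)
  qed
  then show "fst (s n) > 0" "snd (s n) \<ge> 0" by simp_all
qed

lemma fst_solution_Suc:
  assumes "solution a A b s"
  shows "fst (s (Suc n)) = a / (A + snd (s n))"
  using assms by (simp add: solution_def sys_map_def)

lemma snd_solution_Suc:
  assumes "solution a A b s"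
  shows "snd (s (Suc n)) = 1 + b / fst (s n)"
  using assms solution_pos(1)[OF assms, of n]
  by (simp add: solution_def sys_map_def add_divide_distrib)

lemma snd_solution_Suc_Suc:
  assumes "solution a A b s"
  shows "snd (s (Suc (Suc n))) = 1 + b / a * (A + snd (s n))"
  by (simp add: snd_solution_Suc[OF assms] fst_solution_Suc[OF assms])

lemma filterlim_snd_solution_at_top:
  assumes s: "solution a A b s" and "a \<le> b"
  shows "filterlim (\<lambda>n. snd (s n)) at_top sequentially"
proof (rule filterlim_at_top_mono)
  have step: "snd (s n) + 1 \<le> snd (s (Suc (Suc n)))" for n
  proof -
    have "1 * (A + snd (s n)) \<le> b / a * (A + snd (s n))"
      using assms a_pos A_pos solution_pos(2)[OF s, of n] by (intro mult_right_mono) auto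
    then show ?thesis
      using A_pos by (simp add: snd_solution_Suc_Suc[OF s])
  qed
  \<comment> \<open>A gain of 1 per two steps gives slope 1/2. The shift by 1 makes the bound at
    most 0 at both \<open>n = 0\<close> and \<open>n = 1\<close>, where nonnegativity of
    \<open>y\<close> suffices.\<close>
  have "(real n - 1) / 2 \<le> snd (s n)" for n
  proof (induction n rule: induct_nat_012)
    case (ge2 n)
    then show ?case using step[of n] by simp
  qed (use solution_pos(2)[OF s, of 0] solution_pos(2)[OF s, of 1] in simp_all)
  then show "\<forall>\<^sub>F n in sequentially. (real n - 1) / 2 \<le> snd (s n)"
    by simp
  show "filterlim (\<lambda>n. (real n - 1) / 2) at_top sequentially"
    by real_asymp
qed

lemma fst_solution_tendsto_0:
  assumes s: "solution a A b s" and "a \<le> b"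
  shows "(\<lambda>n. fst (s n)) \<longlonglongrightarrow> 0"
proof -
  have "filterlim (\<lambda>n. A + snd (s n)) at_infinity sequentially"
    by (intro filterlim_at_top_imp_at_infinity filterlim_tendsto_add_at_top[OF tendsto_const]
        filterlim_snd_solution_at_top assms)
  \<comment> \<open>The first coordinate is a function of the preceding \<open>y\<close> only from
    index 1 on, hence the shifted sequence.\<close>
  then have "(\<lambda>n. fst (s (Suc n))) \<longlonglongrightarrow> 0"
    unfolding fst_solution_Suc[OF s] by (intro tendsto_divide_0[OF tendsto_const])
  then show ?thesis
    by (rule LIMSEQ_imp_Suc)
qed

end

locale contractive_system = positive_system +
  assumes less: "b < a"
begin

definition x_eq :: real where "x_eq = (a - b) / (A + 1)"

definition y_eq :: real where "y_eq = (a + b * A) / (a - b)"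

lemma x_eq_pos: "x_eq > 0" and y_eq_pos: "y_eq > 0"
  using a_pos A_pos b_pos less by (auto simp: x_eq_def y_eq_def intro!: divide_pos_pos add_pos_pos)

lemma x_eq_eq: "x_eq = a / (A + y_eq)"
proof -
  have "A + y_eq = a * (A + 1) / (a - b)"
    using less by (simp add: y_eq_def field_simps)
  then show ?thesis
    using a_pos A_pos less by (simp add: x_eq_def)
qed

lemma y_eq_eq: "y_eq = 1 + b / x_eq"
  using a_pos A_pos less by (simp add: x_eq_def y_eq_def field_simps)

text \<open>A constant solution satisfies the two-step recurrence for \<open>y\<close>, an affine
  equation of slope \<open>b / a \<noteq> 1\<close>, which has exactly one fixed point;
  \<open>x\<close> is then determined by \<open>y\<close>.\<close>

lemma nonneg_equilibrium_iff: "nonneg_equilibrium a A b p \<longleftrightarrow> p = (x_eq, y_eq)"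
proof
  assume "nonneg_equilibrium a A b p"
  then have s: "solution a A b (\<lambda>n. p)"
    by (simp add: nonneg_equilibrium_def)
  have "snd p = 1 + b / a * (A + snd p)"
    by (rule snd_solution_Suc_Suc[OF s])
  then have "snd p = y_eq"
    using a_pos less by (simp add: y_eq_def field_simps)
  moreover have "fst p = a / (A + snd p)"
    by (rule fst_solution_Suc[OF s])
  ultimately show "p = (x_eq, y_eq)"
    by (simp add: x_eq_eq prod_eq_iff)
next
  have "(b + x_eq) / x_eq = y_eq"
    using x_eq_pos by (simp add: y_eq_eq add_divide_distrib)
  then show "nonneg_equilibrium a A b p" if "p = (x_eq, y_eq)"
    using that admissible_iff[OF a_pos A_pos b_pos] x_eq_pos y_eq_pos
    by (simp add: nonneg_equilibrium_def solution_def sys_map_def flip: x_eq_eq)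
qed

text \<open>Composing the two equilibrium equations shows that \<open>y_eq\<close> is fixed by the
  affine two-step map, so centring there leaves only its linear part.\<close>

lemma snd_solution_diff:
  assumes s: "solution a A b s"
  shows "snd (s (Suc (Suc n))) - y_eq = b / a * (snd (s n) - y_eq)"
proof -
  have "1 + b / a * (A + y_eq) = 1 + b / x_eq"
    by (simp add: x_eq_eq)
  then have "y_eq = 1 + b / a * (A + y_eq)"
    by (simp only: flip: y_eq_eq)
  then show ?thesis
    by (simp add: snd_solution_Suc_Suc[OF s] algebra_simps)
qed

text \<open>Each parity class evolves from its own starting value, so both initial deviations need a
  bound; the factor \<open>b / a < 1\<close> then never enlarges them.\<close>

lemma snd_solution_diff_less:
  assumes s: "solution a A b s"
    and "\<bar>snd (s 0) - y_eq\<bar> < e" "\<bar>snd (s 1) - y_eq\<bar> < e"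
  shows "\<bar>snd (s n) - y_eq\<bar> < e"
proof (induction n rule: induct_nat_012)
  case (ge2 n)
  have "\<bar>snd (s (Suc (Suc n))) - y_eq\<bar> \<le> 1 * \<bar>snd (s n) - y_eq\<bar>"
    unfolding snd_solution_diff[OF s] abs_mult
    using a_pos b_pos less by (intro mult_right_mono) auto
  then show ?case
    using ge2 by (simp only: mult_1)
qed (use assms in simp_all)

lemma snd_solution_tendsto:
  assumes s: "solution a A b s"
  shows "(\<lambda>n. snd (s n)) \<longlonglongrightarrow> y_eq"
proof -
  \<comment> \<open>The offsets \<open>i = 0\<close> and \<open>i = 1\<close> give the even and odd
    subsequences, which together cover the sequence.\<close>
  have geom: "(\<lambda>k. snd (s (2 * k + i))) \<longlonglongrightarrow> y_eq" for i
  proof -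
    have eq: "snd (s (2 * k + i)) - y_eq = (b / a) ^ k * (snd (s i) - y_eq)" for k
      by (induction k) (simp_all add: snd_solution_diff[OF s])
    have "(\<lambda>k. (b / a) ^ k) \<longlonglongrightarrow> 0"
      using a_pos b_pos less by (intro LIMSEQ_realpow_zero) auto
    then have "(\<lambda>k. snd (s (2 * k + i)) - y_eq) \<longlonglongrightarrow> 0"
      unfolding eq by (rule tendsto_mult_left_zero)
    then show ?thesis
      by (simp add: LIM_zero_iff)
  qed
  show ?thesis
    using geom[of 0] geom[of 1] limseq_even_odd[of "\<lambda>n. snd (s n)"]
    by simp
qed

lemma solution_tendsto:
  assumes s: "solution a A b s"
  shows "s \<longlonglongrightarrow> (x_eq, y_eq)"
proof -
  have "(\<lambda>n. fst (s (Suc n))) \<longlonglongrightarrow> x_eq"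
    unfolding fst_solution_Suc[OF s] x_eq_eq
    using A_pos y_eq_pos by (intro tendsto_intros snd_solution_tendsto s) auto
  then have "(\<lambda>n. fst (s n)) \<longlonglongrightarrow> x_eq"
    by (rule LIMSEQ_imp_Suc)
  from tendsto_Pair[OF this snd_solution_tendsto[OF s]] show ?thesis
    by simp
qed

text \<open>The radii are chosen backwards. Continuity of \<open>1 + b / x\<close> turns closeness
  of \<open>x\<close> at time 0 into closeness of \<open>y\<close> at time 1; the contraction then
  controls every \<open>y\<close>, and continuity of \<open>a / (A + y)\<close> controls every later
  \<open>x\<close>.\<close>

lemma lyapunov_stable: "lyapunov_stable a A b (x_eq, y_eq)"
  unfolding lyapunov_stable_def
proof (intro allI impI)
  fix e :: real
  assume "e > 0"
  \<comment> \<open>The filter \<open>nhds\<close> rather than \<open>at\<close> keeps the centre,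
    so the resulting estimate also covers \<open>y = y_eq\<close>.\<close>
  have "((\<lambda>y. a / (A + y)) \<longlongrightarrow> x_eq) (nhds y_eq)"
    unfolding x_eq_eq using A_pos y_eq_pos by (intro tendsto_intros filterlim_ident) auto
  then obtain d1 where d1: "d1 > 0" "\<And>y. \<bar>y - y_eq\<bar> < d1 \<Longrightarrow> \<bar>a / (A + y) - x_eq\<bar> < e / 2"
    using \<open>e > 0\<close> unfolding tendsto_iff eventually_nhds_metric dist_real_def
    by (metis half_gt_zero)
  \<comment> \<open>The bound \<open>d1\<close> on \<open>y\<close> makes the next \<open>x\<close>
    accurate to \<open>e / 2\<close>; the other bound is the share of \<open>y\<close> itself in the
    final error \<open>e\<close>.\<close>
  define d2 where "d2 = min d1 (e / 2)"
  have d2: "d2 > 0" "d2 \<le> d1" "d2 \<le> e / 2"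
    using d1 \<open>e > 0\<close> by (auto simp: d2_def)
  have "((\<lambda>x. 1 + b / x) \<longlongrightarrow> y_eq) (nhds x_eq)"
    unfolding y_eq_eq using x_eq_pos by (intro tendsto_intros filterlim_ident) auto
  then obtain d3 where d3: "d3 > 0" "\<And>x. \<bar>x - x_eq\<bar> < d3 \<Longrightarrow> \<bar>1 + b / x - y_eq\<bar> < d2"
    using \<open>d2 > 0\<close> unfolding tendsto_iff eventually_nhds_metric dist_real_def
    by metis
  \<comment> \<open>Here \<open>d2\<close> handles both coordinates at time 0, and \<open>d3\<close>
    handles \<open>y\<close> at time 1.\<close>
  define d where "d = min d2 d3"
  have "dist (s n) (x_eq, y_eq) < e"
    if s: "solution a A b s" and close: "dist (s 0) (x_eq, y_eq) < d" for s n
  proof -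
    have x0: "\<bar>fst (s 0) - x_eq\<bar> < d" and y0: "\<bar>snd (s 0) - y_eq\<bar> < d"
      using close dist_fst_le[of "s 0" "(x_eq, y_eq)"] dist_snd_le[of "s 0" "(x_eq, y_eq)"]
      by (simp_all add: dist_real_def)
    have "\<bar>snd (s 1) - y_eq\<bar> < d2"
      using d3(2) x0 by (simp add: snd_solution_Suc[OF s] d_def)
    then have y: "\<bar>snd (s m) - y_eq\<bar> < d2" for m
      using y0 snd_solution_diff_less[OF s] by (simp add: d_def)
    have x: "\<bar>fst (s n) - x_eq\<bar> < e / 2"
    \<comment> \<open>At time 0 the first coordinate is free data, bounded by \<open>d\<close>
      directly; later it comes from the preceding \<open>y\<close>.\<close>
    proof (cases n)
      case 0
      then show ?thesis using x0 d2 by (simp add: d_def)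
    next
      case (Suc m)
      then show ?thesis
        using d1(2)[of "snd (s m)"] y[of m] d2 by (simp add: fst_solution_Suc[OF s])
    qed
    have "dist (s n) (x_eq, y_eq) \<le> \<bar>fst (s n) - x_eq\<bar> + \<bar>snd (s n) - y_eq\<bar>"
      using sqrt_sum_squares_le_sum_abs[of "fst (s n) - x_eq" "snd (s n) - y_eq"]
      by (simp add: dist_prod_def dist_real_def)
    then show ?thesis
      using x y[of n] d2 by linarith
  qed
  moreover have "d > 0"
    using d2 d3 by (simp add: d_def)
  ultimately show "\<exists>d>0. \<forall>s. solution a A b s \<longrightarrow> dist (s 0) (x_eq, y_eq) < d \<longrightarrow>
      (\<forall>n. dist (s n) (x_eq, y_eq) < e)"
    by blast
qed

end

theorem theorem15:
  fixes \<alpha>1 A1 \<alpha>2 :: real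
  assumes "\<alpha>1 > 0" and "A1 > 0" and "\<alpha>2 > 0"
  shows "(\<alpha>1 > \<alpha>2 \<longrightarrow>
            (\<forall>p. nonneg_equilibrium \<alpha>1 A1 \<alpha>2 p \<longleftrightarrow>
                 p = ((\<alpha>1 - \<alpha>2) / (A1 + 1), (\<alpha>1 + \<alpha>2 * A1) / (\<alpha>1 - \<alpha>2))) \<and>
            globally_asymptotically_stable \<alpha>1 A1 \<alpha>2
              ((\<alpha>1 - \<alpha>2) / (A1 + 1), (\<alpha>1 + \<alpha>2 * A1) / (\<alpha>1 - \<alpha>2))) \<and>
         (\<alpha>1 \<le> \<alpha>2 \<longrightarrow>
            (\<forall>x y. solution \<alpha>1 A1 \<alpha>2 (\<lambda>n. (x n, y n)) \<longrightarrow>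
                 x \<longlonglongrightarrow> 0 \<and> filterlim y at_top sequentially))"
proof (intro conjI impI)
  have pos: "positive_system \<alpha>1 A1 \<alpha>2"
    using assms by unfold_locales
  {
    assume "\<alpha>2 < \<alpha>1"
    interpret contractive_system \<alpha>1 A1 \<alpha>2
      using assms \<open>\<alpha>2 < \<alpha>1\<close> by unfold_locales
    show "\<forall>p. nonneg_equilibrium \<alpha>1 A1 \<alpha>2 p \<longleftrightarrow>
        p = ((\<alpha>1 - \<alpha>2) / (A1 + 1), (\<alpha>1 + \<alpha>2 * A1) / (\<alpha>1 - \<alpha>2))"
      using nonneg_equilibrium_iff by (simp add: x_eq_def y_eq_def)
    show "globally_asymptotically_stable \<alpha>1 A1 \<alpha>2
        ((\<alpha>1 - \<alpha>2) / (A1 + 1), (\<alpha>1 + \<alpha>2 * A1) / (\<alpha>1 - \<alpha>2))"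
      using lyapunov_stable solution_tendsto
      by (simp add: globally_asymptotically_stable_def x_eq_def y_eq_def)
  }
  assume "\<alpha>1 \<le> \<alpha>2"
  then show "\<forall>x y. solution \<alpha>1 A1 \<alpha>2 (\<lambda>n. (x n, y n)) \<longrightarrow>
      x \<longlonglongrightarrow> 0 \<and> filterlim y at_top sequentially"
    \<comment> \<open>Both limits are taken for the paired sequence
      \<open>\<lambda>n. (x n, y n)\<close>, whose projections are \<open>x\<close> and
      \<open>y\<close>.\<close>
    using positive_system.fst_solution_tendsto_0[OF pos]
      positive_system.filterlim_snd_solution_at_top[OF pos] by fastforce
qed

end
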